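(* Let $\{\nu_k\}_{k=1}^N\subset\mathbb{Z}^+$ be strictly increasing, where either $N<\infty$ or $N=\infty$, and let $\Lambda_n=\min_{m\ne n}|\nu_m-\nu_n|$. Let $\{a_k\}_{k=1}^N\subset\mathbb{C}\setminus\{0\}$ be any sequence such that, if $N=\infty$, the series $\sum_{k=1}^N a_k\sin(2\pi\nu_k x)$ converges to an $L^\infty$ function. Then for each $\alpha\in[0,1]$ and each $n$ with $1<n<N$, the inequality \[ \Big|\sum_{k=1}^N a_k\sin(2\pi\nu_k x)\Big| > \frac14\,\mathcal{B}_{n,\alpha}\,|a_n|\,|x|^\alpha \] holds for all $x$ in a subset of $[-\tfrac12,\tfrac12]$ of positive Lebesgue measure, where \[ \mathcal{B}_{n,\alpha}=\frac{\pi^{\alpha-1}(1-\alpha^2)\Lambda_n}{\Lambda_n^{1-\alpha}-(1/5)^{1-\alpha}}\quad\text{for }\alpha\ne1,\qquad \mathcal{B}_{n,1}=\lim_{\alpha\to1^-}\mathcal{B}_{n,\alpha}. \] *)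

theory Defs
  imports "HOL-Analysis.Analysis"
begin

definition idx :: "enat \<Rightarrow> nat set" where
  "idx N = {k. 1 \<le> k \<and> enat k \<le> N}"

text \<open>The infimum is taken in \<^typ>\<open>nat\<close>, so it is attained whenever there is
  an index different from \<open>n\<close>.\<close>

definition gap :: "enat \<Rightarrow> (nat \<Rightarrow> nat) \<Rightarrow> nat \<Rightarrow> nat" where
  "gap N \<nu> n = (INF m\<in>idx N - {n}. nat \<bar>int (\<nu> m) - int (\<nu> n)\<bar>)"

definition B_formula :: "real \<Rightarrow> real \<Rightarrow> real" where
  "B_formula \<Lambda> \<alpha> =
     pi powr (\<alpha> - 1) * (1 - \<alpha>\<^sup>2) * \<Lambda> / (\<Lambda> powr (1 - \<alpha>) - (1/5) powr (1 - \<alpha>))"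

definition B_const :: "real \<Rightarrow> real \<Rightarrow> real" where
  "B_const \<Lambda> \<alpha> =
     (if \<alpha> = 1 then Lim (at_left 1) (B_formula \<Lambda>) else B_formula \<Lambda> \<alpha>)"

definition sine_term :: "(nat \<Rightarrow> nat) \<Rightarrow> (nat \<Rightarrow> complex) \<Rightarrow> nat \<Rightarrow> real \<Rightarrow> complex" where
  "sine_term \<nu> a k x = a k * complex_of_real (sin (2 * pi * real (\<nu> k) * x))"

abbreviation unit_period :: "real measure" where
  "unit_period \<equiv> lebesgue_on {-1/2..1/2}"

definition L_infinity :: "(real \<Rightarrow> complex) \<Rightarrow> bool" where
  "L_infinity f \<longleftrightarrow>
     f \<in> borel_measurable unit_period \<and> (\<exists>C. AE x in unit_period. cmod (f x) \<le> C)"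

text \<open>
  \<open>is_sine_sum N \<nu> a f\<close>: the function \<open>f\<close> is the sum of the (finite or infinite) sine series.
  For an infinite series, convergence to an \<open>L\<^sup>\<infinity>\<close> function is convergence of the partial
  sums in \<open>L\<^sup>1\<close> over one period.  On a period this is implied by convergence in \<open>L\<^sup>p\<close>
  for every \<open>1 \<le> p \<le> \<infinity>\<close>, and for an essentially bounded limit it is equivalent to \<open>L\<^sup>2\<close>
  convergence, i.e. to the series being the Fourier series of \<open>f\<close>.  Mere convergence
  almost everywhere would not do: there are sine series with nonzero coefficients
  converging to 0 almost everywhere.
\<close>

definition is_sine_sum ::
  "enat \<Rightarrow> (nat \<Rightarrow> nat) \<Rightarrow> (nat \<Rightarrow> complex) \<Rightarrow> (real \<Rightarrow> complex) \<Rightarrow> bool" where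
  "is_sine_sum N \<nu> a f \<longleftrightarrow>
     (case N of
        enat M \<Rightarrow> \<forall>x. f x = (\<Sum>k=1..M. sine_term \<nu> a k x)
      | \<infinity> \<Rightarrow> L_infinity f \<and>
          (\<lambda>M. LINT x|unit_period. cmod ((\<Sum>k=1..M. sine_term \<nu> a k x) - f x))
            \<longlonglongrightarrow> 0)"

end

theory Submission
  imports Defs
begin

text \<open>
  Suppose \<open>\<bar>f x\<bar> \<le> C \<bar>x\<bar>\<^sup>\<alpha>\<close> almost everywhere. The Fejer kernel \<open>F\<close> of order
  \<open>\<Lambda>\<^sub>n\<close> has frequencies strictly between \<open>-\<Lambda>\<^sub>n\<close> and \<open>\<Lambda>\<^sub>n\<close>, so integrating \<open>f\<close> against
  \<open>F x \<cdot> cis (- 2 \<pi> \<nu>\<^sub>n x)\<close> over a period isolates \<open>a\<^sub>n / 2\<i>\<close>; hence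
  \<open>\<bar>a\<^sub>n\<bar> / 2 \<le> C \<integral> \<bar>x\<bar>\<^sup>\<alpha> F\<close>. Splitting the integral of
  \<open>F x \<le> min \<Lambda>\<^sub>n (1 / (4 \<Lambda>\<^sub>n x\<^sup>2))\<close> at \<open>\<bar>x\<bar> = 1 / (2 \<Lambda>\<^sub>n)\<close> gives
  \<open>\<integral> \<bar>x\<bar>\<^sup>\<alpha> F \<le> 1 / \<B>\<^bsub>n,\<alpha>\<^esub>\<close>, so \<open>C \<ge> \<B>\<^bsub>n,\<alpha>\<^esub> \<bar>a\<^sub>n\<bar> / 2\<close>, twice the
  constant of the theorem. The case \<open>\<alpha> = 1\<close> follows by letting \<open>\<alpha>\<close> tend to 1 from below,
  because the moment decreases in \<open>\<alpha>\<close>.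
\<close>

section \<open>The Fejer kernel: pointwise bounds, symmetry and Fourier expansion\<close>

text \<open>For positive \<open>L\<close> this is the trigonometric polynomial with coefficients
  \<open>1 - \<bar>m\<bar> / L\<close> at the frequencies \<open>\<bar>m\<bar> < L\<close>. The
  square makes it nonnegative, and dividing by \<open>L\<close> normalises its mean over a period to
  1.\<close>

definition fejer_kernel :: "nat \<Rightarrow> real \<Rightarrow> real" where
  "fejer_kernel L x = (cmod (\<Sum>j<L. cis (2 * pi * real j * x)))\<^sup>2 / real L"

lemma fejer_kernel_nonneg: "0 \<le> fejer_kernel L x"
  by (simp add: fejer_kernel_def)

lemma fejer_kernel_le: "fejer_kernel L x \<le> real L"
proof -
  have "cmod (\<Sum>j<L. cis (2 * pi * real j * x)) \<le> (\<Sum>j<L. 1)"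
    by (rule sum_norm_le) simp
  then have "(cmod (\<Sum>j<L. cis (2 * pi * real j * x)))\<^sup>2 \<le> (real L)\<^sup>2"
    by (intro power_mono) auto
  then show ?thesis
    by (cases "L = 0") (auto simp: fejer_kernel_def field_simps power2_eq_square)
qed

lemma fejer_kernel_uminus: "fejer_kernel L (- x) = fejer_kernel L x"
proof -
  have "(\<Sum>j<L. cis (2 * pi * real j * (- x))) = cnj (\<Sum>j<L. cis (2 * pi * real j * x))"
    by (simp add: cis_cnj)
  then show ?thesis
    by (simp only: fejer_kernel_def complex_mod_cnj)
qed

lemma continuous_fejer_kernel: "continuous_on A (fejer_kernel L)"
  unfolding fejer_kernel_def cis_conv_exp by (cases "L = 0") (auto intro!: continuous_intros)

text \<open>Multiplying the exponential sum by its conjugate produces the frequencies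
  \<open>j - l\<close>, all of modulus less than \<open>L\<close>. The double sum is not grouped by
  frequency, so that it can later be integrated term by term.\<close>

lemma of_real_fejer_kernel:
  "complex_of_real (fejer_kernel L x) =
     (\<Sum>j<L. \<Sum>l<L. cis (2 * pi * real_of_int (int j - int l) * x)) / of_nat L"
proof -
  have "complex_of_real (fejer_kernel L x) =
    (\<Sum>j<L. cis (2 * pi * real j * x)) * cnj (\<Sum>l<L. cis (2 * pi * real l * x)) / of_nat L"
    unfolding fejer_kernel_def of_real_divide complex_norm_square of_real_of_nat_eq ..
  also have "\<dots> = (\<Sum>j<L. \<Sum>l<L. cis (2 * pi * real j * x) * cis (- (2 * pi * real l * x))) / of_nat L"
    by (simp add: sum_product cis_cnj)
  also have "\<dots> = (\<Sum>j<L. \<Sum>l<L. cis (2 * pi * real_of_int (int j - int l) * x)) / of_nat L"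
    by (simp add: cis_mult algebra_simps)
  finally show ?thesis .
qed

text \<open>Jordan's inequality: sine is concave on \<open>{0..pi}\<close>, so on
  \<open>{0..pi/2}\<close> its graph lies above the chord from the origin to
  \<open>(pi/2, 1)\<close>.\<close>

lemma sin_ge_two_over_pi_times:
  assumes "0 \<le> x" "x \<le> pi / 2"
  shows "2 / pi * x \<le> sin x"
proof -
  have "convex_on {0..pi} (\<lambda>x. - sin x)"
  proof (rule f''_ge0_imp_convex)
    show "((\<lambda>x. - sin x) has_real_derivative - cos x) (at x)" for x :: real
      by (auto intro!: derivative_eq_intros)
    show "((\<lambda>x. - cos x) has_real_derivative sin x) (at x)" for x :: real
      by (auto intro!: derivative_eq_intros)
  qed (auto intro: sin_ge_zero)
  from convex_onD[OF this, of "2 / pi * x" 0 "pi / 2"] assms show ?thesis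
    by (simp add: field_simps)
qed

text \<open>With \<open>z = cis (2 * pi * x)\<close>, the geometric sum satisfies
  \<open>(z - 1) * D = z ^ L - 1\<close>, whose modulus is at most 2, while Jordan's inequality
  keeps \<open>z - 1\<close> at distance at least \<open>4 * x\<close> from 0.\<close>

lemma fejer_kernel_le_inverse_square:
  assumes "0 < x" "x \<le> 1 / 2"
  shows "fejer_kernel L x \<le> 1 / (4 * real L * x\<^sup>2)"
proof -
  define D where "D = (\<Sum>j<L. cis (2 * pi * real j * x))"
  have D: "D = (\<Sum>j<L. cis (2 * pi * x) ^ j)"
    unfolding D_def by (intro sum.cong refl) (subst Complex.DeMoivre, simp only: ac_simps)
  have "(cis (2 * pi * x) - 1) * D = cis (2 * pi * x) ^ L - 1"
    unfolding D by (simp add: power_diff_1_eq)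
  then have "cmod (cis (2 * pi * x) - 1) * cmod D = cmod (cis (2 * pi * x) ^ L - 1)"
    by (metis norm_mult)
  also have "\<dots> \<le> 2"
    using norm_triangle_ineq4[of "cis (2 * pi * x) ^ L" 1] by (simp add: norm_power)
  finally have *: "cmod (cis (2 * pi * x) - 1) * cmod D \<le> 2" .
  \<comment> \<open>Factoring out the half-angle rotation leaves a multiple of
    \<open>sin (pi * x)\<close>, and \<open>pi * x\<close> lies in the range of Jordan's
    inequality.\<close>
  have "cis (2 * pi * x) - 1 = 2 * \<i> * of_real (sin (pi * x)) * cis (pi * x)"
    using cos_double_sin[of "pi * x"] sin_double[of "pi * x"]
    by (simp add: complex_eq_iff power2_eq_square mult_ac)
  then have "cmod (cis (2 * pi * x) - 1) = 2 * \<bar>sin (pi * x)\<bar>"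
    by (simp add: norm_mult)
  moreover have "2 * x \<le> sin (pi * x)"
    using sin_ge_two_over_pi_times[of "pi * x"] assms by (simp add: field_simps)
  ultimately have "4 * x * cmod D \<le> cmod (cis (2 * pi * x) - 1) * cmod D"
    by (intro mult_right_mono) auto
  with * have "2 * x * cmod D \<le> 1" by linarith
  then have "(2 * x * cmod D)\<^sup>2 \<le> 1"
    using assms by (simp add: power_le_one)
  then show ?thesis
    using assms unfolding fejer_kernel_def D_def[symmetric]
    by (cases "L = 0") (auto simp: field_simps power2_eq_square)
qed

section \<open>Integrals of exponentials over a period\<close>

lemma has_bochner_integral_cis_period:
  fixes m :: int
  shows "has_bochner_integral unit_period (\<lambda>x. cis (2 * pi * real_of_int m * x))
    (if m = 0 then 1 else 0)"
proof -
  have int: "integrable unit_period (\<lambda>x. cis (2 * pi * real_of_int m * x))"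
    unfolding cis_conv_exp by (intro continuous_imp_integrable_real continuous_intros)
  have "((\<lambda>x. cis (2 * pi * real_of_int m * x)) has_integral (if m = 0 then 1 else 0)) {-1/2..1/2}"
  proof (cases "m = 0")
    case True
    then show ?thesis using has_integral_const_real[of "1::complex" "-1/2" "1/2"] by simp
  next
    case False
    define g where "g x = cis (2 * pi * real_of_int m * x) / (2 * pi * \<i> * of_int m)" for x
    have "((\<lambda>x. cis (2 * pi * real_of_int m * x)) has_integral (g (1/2) - g (-1/2))) {-1/2..1/2}"
    proof (rule fundamental_theorem_of_calculus)
      fix x :: real
      have "(g has_vector_derivative cis (2 * pi * real_of_int m * x)) (at x)"
        unfolding g_def cis_conv_exp of_real_mult mult.assoc[symmetric]
        by (rule has_vector_derivative_real_field)
          (use False in \<open>auto intro!: derivative_eq_intros simp: field_simps\<close>)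
      then show "(g has_vector_derivative cis (2 * pi * real_of_int m * x)) (at x within {-1/2..1/2})"
        by (rule has_vector_derivative_at_within)
    qed simp
    \<comment> \<open>The antiderivative has period 1 because \<open>m\<close> is an integer: the
      two values of \<open>cis\<close> differ only in the sign of
      \<open>sin (pi * m) = 0\<close>.\<close>
    moreover have "g (1/2) = g (-1/2)"
    proof -
      have "cis (pi * real_of_int m) = cis (- (pi * real_of_int m))"
        by (simp add: complex_eq_iff)
      then show ?thesis by (simp add: g_def)
    qed
    ultimately show ?thesis using False by simp
  qed
  then show ?thesis
    using int lebesgue_integral_eq_integral[OF int]
    by (simp add: has_bochner_integral_iff integral_unique)
qed

section \<open>The constant of the theorem and its limit at \<alpha> = 1\<close>

text \<open>Since 5 exceeds e, \<open>5 powr s\<close> is at least \<open>1 + s\<close>, and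
  \<open>1 / (1 + s) \<le> 1 - s / 2\<close> on the unit interval. At
  \<open>s = 1 - \<alpha>\<close> the right side is \<open>(1 + \<alpha>) / 2\<close>, the term to
  be compared with the power of 1/5 in the denominator of \<open>B_formula\<close>.\<close>

lemma one_fifth_powr_le:
  fixes s :: real
  assumes "0 \<le> s" "s \<le> 1"
  shows "(1/5) powr s \<le> 1 - s / 2"
proof -
  have "(1::real) \<le> ln 5"
    using exp_le by (subst ln_ge_iff) auto
  then have "1 + s \<le> 1 + s * ln 5"
    using assms by (simp add: mult_le_cancel_left1)
  also have "\<dots> \<le> 5 powr s"
    by (simp add: powr_def exp_ge_add_one_self)
  finally have "(1/5) powr s \<le> 1 / (1 + s)"
    using assms by (simp add: powr_divide frac_le)
  also have "\<dots> \<le> 1 - s / 2"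
    using assms mult_left_mono[of s 1 s] by (simp add: field_simps)
  finally show ?thesis .
qed

text \<open>With \<open>s = 1 - \<alpha>\<close>, the factor \<open>1 - \<alpha>\<^sup>2\<close> is
  \<open>s * (1 + \<alpha>)\<close>. Its \<open>s\<close> turns the denominator into the difference
  quotient \<open>q\<close> at 0 of \<open>\<Lambda> powr s - (1/5) powr s\<close>, whose limit is
  \<open>ln \<Lambda> + ln 5\<close>.\<close>

lemma B_formula_tendsto:
  fixes \<Lambda> :: real
  assumes "1 \<le> \<Lambda>"
  shows "(B_formula \<Lambda> \<longlongrightarrow> 2 * \<Lambda> / ln (5 * \<Lambda>)) (at_left 1)"
proof -
  define q where "q s = (\<Lambda> powr s - (1/5) powr s) / s" for s
  have "((\<lambda>s. \<Lambda> powr s - (1/5) powr s) has_real_derivative ln (5 * \<Lambda>)) (at 0)"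
    using assms by (auto intro!: derivative_eq_intros simp: ln_mult ln_div)
  then have "(q \<longlongrightarrow> ln (5 * \<Lambda>)) (at 0)"
    using assms unfolding DERIV_def q_def by simp
  moreover have "filterlim (\<lambda>\<alpha>. 1 - \<alpha> :: real) (at 0) (at_left 1)"
    by (rule filterlim_atI) (auto intro!: tendsto_eq_intros simp: eventually_at_filter)
  ultimately have "((\<lambda>\<alpha>. q (1 - \<alpha>)) \<longlongrightarrow> ln (5 * \<Lambda>)) (at_left 1)"
    by (rule filterlim_compose)
  then have "((\<lambda>\<alpha>. pi powr (\<alpha> - 1) * (1 + \<alpha>) * \<Lambda> / q (1 - \<alpha>)) \<longlongrightarrow>
      pi powr (1 - 1) * (1 + 1) * \<Lambda> / ln (5 * \<Lambda>)) (at_left 1)"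
    using assms by (intro tendsto_intros) auto
  moreover have "\<forall>\<^sub>F \<alpha> in at_left 1.
      pi powr (\<alpha> - 1) * (1 + \<alpha>) * \<Lambda> / q (1 - \<alpha>) = B_formula \<Lambda> \<alpha>"
    unfolding eventually_at_filter
    by (rule always_eventually) (auto simp: B_formula_def q_def power2_eq_square field_simps)
  ultimately show ?thesis
    by (auto dest: Lim_transform_eventually)
qed

section \<open>Moments of the Fejer kernel\<close>

lemma integrable_powr_times_fejer_kernel:
  assumes "0 \<le> \<alpha>"
  shows "integrable unit_period (\<lambda>x. \<bar>x\<bar> powr \<alpha> * fejer_kernel L x)"
proof (rule Bochner_Integration.integrable_bound)
  show "integrable unit_period (\<lambda>_. real L)"
    by (intro continuous_imp_integrable_real continuous_intros)
  have [measurable]: "fejer_kernel L \<in> borel_measurable borel"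
    by (intro borel_measurable_continuous_onI continuous_fejer_kernel)
  have "(\<lambda>x. \<bar>x\<bar> powr \<alpha> * fejer_kernel L x) \<in> borel_measurable lborel"
    by measurable
  then show "(\<lambda>x. \<bar>x\<bar> powr \<alpha> * fejer_kernel L x) \<in> borel_measurable unit_period"
    by (intro measurable_restrict_space1 measurable_completion)
  show "AE x in unit_period. norm (\<bar>x\<bar> powr \<alpha> * fejer_kernel L x) \<le> norm (real L)"
  proof (rule AE_I2)
    fix x assume "x \<in> space unit_period"
    then have "\<bar>x\<bar> powr \<alpha> \<le> 1"
      using assms by (intro powr_le1) auto
    then have "\<bar>x\<bar> powr \<alpha> * fejer_kernel L x \<le> 1 * real L"
      by (intro mult_mono fejer_kernel_le fejer_kernel_nonneg) auto
    then show "norm (\<bar>x\<bar> powr \<alpha> * fejer_kernel L x) \<le> norm (real L)"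
      by (simp add: abs_mult fejer_kernel_nonneg)
  qed
qed

text \<open>The bound is the exact moment of the majorant
  \<open>min L (1 / (4 * L * x\<^sup>2))\<close>, computed on the half period by evenness. For
  \<alpha> < 1 the outer piece has a power as antiderivative.\<close>

lemma integral_powr_times_fejer_kernel_le:
  assumes \<alpha>: "0 \<le> \<alpha>" "\<alpha> < 1" and L: "0 < L"
  shows "(LINT x|unit_period. \<bar>x\<bar> powr \<alpha> * fejer_kernel L x) \<le>
    2 powr (1 - \<alpha>) * (real L powr (1 - \<alpha>) - (1 + \<alpha>) / 2) / ((1 - \<alpha>\<^sup>2) * real L)"
proof -
  define k where "k x = \<bar>x\<bar> powr \<alpha> * fejer_kernel L x" for x
  \<comment> \<open>The two bounds of the kernel, \<open>L\<close> and
    \<open>1 / (4 * L * x\<^sup>2)\<close>, cross at this point.\<close>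
  define c where "c = 1 / (2 * real L)"
  have c: "0 < c" "c \<le> 1 / 2"
    using L by (auto simp: c_def field_simps)
  have int: "integrable unit_period k"
    unfolding k_def using \<alpha> by (intro integrable_powr_times_fejer_kernel)
  then have k: "k integrable_on {-1/2..1/2}"
    by (simp add: integrable_on_lebesgue_on)
  have sub: "k integrable_on {u..v}" if "-1/2 \<le> u" "v \<le> 1/2" for u v
    using integrable_on_subinterval[OF k] that by auto
  have near: "integral {0..c} k \<le> real L * (c powr (\<alpha> + 1) / (\<alpha> + 1))"
  proof (rule has_integral_le)
    show "(k has_integral integral {0..c} k) {0..c}"
      using sub c by (intro integrable_integral) auto
    show "((\<lambda>x. real L * x powr \<alpha>) has_integral real L * (c powr (\<alpha> + 1) / (\<alpha> + 1))) {0..c}"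
      using \<alpha> c by (intro has_integral_mult_right has_integral_powr_from_0) auto
    show "k x \<le> real L * x powr \<alpha>" if "x \<in> {0..c}" for x
      using that mult_left_mono[OF fejer_kernel_le[of L x], of "x powr \<alpha>"]
      by (simp add: k_def mult.commute)
  qed
  have far: "integral {c..1/2} k \<le>
      1 / (4 * real L) * ((1/2) powr (\<alpha> - 1) / (\<alpha> - 1) - c powr (\<alpha> - 1) / (\<alpha> - 1))"
  proof (rule has_integral_le)
    show "(k has_integral integral {c..1/2} k) {c..1/2}"
      using sub c by (intro integrable_integral) auto
    have "((\<lambda>x. x powr (\<alpha> - 2)) has_integral
        ((1/2) powr (\<alpha> - 1) / (\<alpha> - 1) - c powr (\<alpha> - 1) / (\<alpha> - 1))) {c..1/2}"
    proof (rule fundamental_theorem_of_calculus)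
      fix x assume "x \<in> {c..1/2}"
      then have "0 < x" using c by simp
      from DERIV_cdivide[OF has_real_derivative_powr[OF this, of "\<alpha> - 1"], of "\<alpha> - 1"]
      have "((\<lambda>x. x powr (\<alpha> - 1) / (\<alpha> - 1)) has_real_derivative x powr (\<alpha> - 2)) (at x)"
        using \<alpha> by simp
      then show "((\<lambda>x. x powr (\<alpha> - 1) / (\<alpha> - 1)) has_vector_derivative x powr (\<alpha> - 2))
          (at x within {c..1/2})"
        unfolding has_real_derivative_iff_has_vector_derivative
        by (rule has_vector_derivative_at_within)
    qed (use c in auto)
    then show "((\<lambda>x. 1 / (4 * real L) * x powr (\<alpha> - 2)) has_integral
      1 / (4 * real L) * ((1/2) powr (\<alpha> - 1) / (\<alpha> - 1) - c powr (\<alpha> - 1) / (\<alpha> - 1))) {c..1/2}"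
      by (rule has_integral_mult_right)
    show "k x \<le> 1 / (4 * real L) * x powr (\<alpha> - 2)" if "x \<in> {c..1/2}" for x
    proof -
      have x: "0 < x" "x \<le> 1/2" using that c by auto
      then have "k x \<le> x powr \<alpha> * (1 / (4 * real L * x\<^sup>2))"
        unfolding k_def using fejer_kernel_le_inverse_square[of x L] by (intro mult_mono) (auto simp: fejer_kernel_nonneg)
      also have "\<dots> = 1 / (4 * real L) * x powr (\<alpha> - 2)"
        using x by (simp add: powr_diff)
      finally show ?thesis .
    qed
  qed
  have "integral {0..1/2} k = integral {0..c} k + integral {c..1/2} k"
    using c sub by (intro Henstock_Kurzweil_Integration.integral_combine[symmetric]) auto
  moreover have "integral {-1/2..1/2} k = integral {-1/2..0} k + integral {0..1/2} k"
    using c sub by (intro Henstock_Kurzweil_Integration.integral_combine[symmetric]) auto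
  moreover have "integral {-1/2..0} k = integral {0..1/2} k"
    using Henstock_Kurzweil_Integration.integral_reflect_real[of "1/2" 0 k]
    by (simp add: k_def[abs_def] fejer_kernel_uminus)
  moreover have "(LINT x|unit_period. k x) = integral {-1/2..1/2} k"
    using int by (intro lebesgue_integral_eq_integral) auto
  ultimately have "(LINT x|unit_period. k x) = 2 * (integral {0..c} k + integral {c..1/2} k)"
    by simp
  also have "\<dots> \<le> 2 * (real L * (c powr (\<alpha> + 1) / (\<alpha> + 1)) +
      1 / (4 * real L) * ((1/2) powr (\<alpha> - 1) / (\<alpha> - 1) - c powr (\<alpha> - 1) / (\<alpha> - 1)))"
    by (intro mult_left_mono add_mono near far) simp
  also have "\<dots> =
    2 powr (1 - \<alpha>) * (real L powr (1 - \<alpha>) - (1 + \<alpha>) / 2) / ((1 - \<alpha>\<^sup>2) * real L)"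
  proof -
    define P where "P = 2 powr (1 - \<alpha>)"
    define Q where "Q = real L powr (1 - \<alpha>)"
    have 1: "(1/2) powr (\<alpha> - 1) = P"
      by (simp add: P_def powr_divide powr_diff)
    \<comment> \<open>Since \<open>1 / c = 2 * L\<close>, every power of \<open>c\<close> reduces to
      \<open>P\<close>, \<open>Q\<close> and an integer power of \<open>L\<close>; the rest is
      rational algebra.\<close>
    have 2: "c powr (\<alpha> - 1) = P * Q"
      using L by (simp add: c_def P_def Q_def powr_divide powr_mult powr_diff)
    have "c powr (\<alpha> + 1) = c powr (\<alpha> - 1) * c powr 2"
      by (simp add: powr_add[symmetric] add.commute)
    also have "c powr 2 = c\<^sup>2"
      using c by simp
    also have "\<dots> = 1 / (4 * (real L)\<^sup>2)"
      by (simp add: c_def power_divide power_mult_distrib)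
    finally have 3: "c powr (\<alpha> + 1) = P * Q / (4 * (real L)\<^sup>2)"
      by (simp add: 2)
    have "2 * (real L * (P * Q / (4 * (real L)\<^sup>2) / (\<alpha> + 1)) +
        1 / (4 * real L) * (P / (\<alpha> - 1) - P * Q / (\<alpha> - 1))) =
        P / (2 * real L) * (Q / (1 + \<alpha>) + (Q - 1) / (1 - \<alpha>))"
    proof -
      have "P / (\<alpha> - 1) - P * Q / (\<alpha> - 1) = P * ((Q - 1) / (1 - \<alpha>))"
        using \<alpha> by (simp add: divide_simps) (simp add: algebra_simps)
      moreover have "real L * (P * Q / (4 * (real L)\<^sup>2) / (\<alpha> + 1)) =
          1 / (4 * real L) * (P * (Q / (1 + \<alpha>)))"
        using L by (simp add: power2_eq_square add.commute)
      ultimately show ?thesis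
        by (simp only: distrib_left[symmetric]) simp
    qed
    also have "Q / (1 + \<alpha>) + (Q - 1) / (1 - \<alpha>) = (Q - (1 + \<alpha>) / 2) * 2 / (1 - \<alpha>\<^sup>2)"
    proof -
      have "1 - \<alpha>\<^sup>2 = (1 + \<alpha>) * (1 - \<alpha>)" by (simp add: power2_eq_square algebra_simps)
      moreover have "Q * (1 - \<alpha>) + (Q - 1) * (1 + \<alpha>) = (Q - (1 + \<alpha>) / 2) * 2"
        by (simp add: algebra_simps)
      ultimately show ?thesis using \<alpha> by (simp add: add_frac_eq)
    qed
    also have "P / (2 * real L) * ((Q - (1 + \<alpha>) / 2) * 2 / (1 - \<alpha>\<^sup>2)) =
        P * (Q - (1 + \<alpha>) / 2) / ((1 - \<alpha>\<^sup>2) * real L)"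
    proof -
      have "p / (2 * l) * (q * 2 / d) = p * q / (d * l)" for p q l d :: real
        by simp
      then show ?thesis .
    qed
    finally show ?thesis
      unfolding 1 2 3 P_def[symmetric] Q_def[symmetric] .
  qed
  finally show ?thesis by (simp add: k_def)
qed

text \<open>After cancellation the product is at most the ratio of
  \<open>2 powr (1 - \<alpha>) * X\<close> to \<open>pi powr (1 - \<alpha>) * Y\<close>. Here 2 is
  less than pi, and \<open>X \<le> Y\<close> is the estimate for the power of 1/5.\<close>

lemma B_formula_times_integral_le:
  assumes \<alpha>: "0 \<le> \<alpha>" "\<alpha> < 1" and L: "0 < L"
  shows "B_formula (real L) \<alpha> * (LINT x|unit_period. \<bar>x\<bar> powr \<alpha> * fejer_kernel L x) \<le> 1"
proof -
  define X where "X = real L powr (1 - \<alpha>) - (1 + \<alpha>) / 2"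
  define Y where "Y = real L powr (1 - \<alpha>) - (1/5) powr (1 - \<alpha>)"
  have "1 \<le> real L powr (1 - \<alpha>)"
    using \<alpha> L by (intro ge_one_powr_ge_zero) auto
  then have X: "0 < X" using \<alpha> by (simp add: X_def)
  have XY: "X \<le> Y"
    using one_fifth_powr_le[of "1 - \<alpha>"] \<alpha> by (simp add: X_def Y_def field_simps)
  have "\<alpha> * \<alpha> < 1" using \<alpha> mult_strict_mono[of \<alpha> 1 \<alpha> 1] by auto
  then have *: "0 < 1 - \<alpha>\<^sup>2" by (simp add: power2_eq_square)
  have B: "B_formula (real L) \<alpha> = (1 - \<alpha>\<^sup>2) * real L / (pi powr (1 - \<alpha>) * Y)"
    by (simp add: B_formula_def Y_def powr_diff field_simps)
  then have "0 \<le> B_formula (real L) \<alpha>" using * X XY by simp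
  then have "B_formula (real L) \<alpha> * (LINT x|unit_period. \<bar>x\<bar> powr \<alpha> * fejer_kernel L x) \<le>
      B_formula (real L) \<alpha> * (2 powr (1 - \<alpha>) * X / ((1 - \<alpha>\<^sup>2) * real L))"
    unfolding X_def using assms by (intro mult_left_mono integral_powr_times_fejer_kernel_le)
  also have "\<dots> = (2 powr (1 - \<alpha>) * X) / (pi powr (1 - \<alpha>) * Y)"
    unfolding B using * L by simp
  also have "\<dots> \<le> 1"
  proof -
    have "2 powr (1 - \<alpha>) * X \<le> pi powr (1 - \<alpha>) * Y"
      using \<alpha> X XY pi_gt3 by (intro mult_mono powr_mono2) auto
    then show ?thesis using X XY by (simp add: divide_le_eq_1)
  qed
  finally show ?thesis .
qed

lemma B_const_times_integral_le:
  assumes \<alpha>: "\<alpha> \<in> {0..1}" and L: "0 < L"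
  shows "B_const (real L) \<alpha> * (LINT x|unit_period. \<bar>x\<bar> powr \<alpha> * fejer_kernel L x) \<le> 1"
proof (cases "\<alpha> = 1")
  case False
  with assms show ?thesis
    unfolding B_const_def using B_formula_times_integral_le[of \<alpha> L] by auto
next
  case True
  define J where "J \<alpha> = (LINT x|unit_period. \<bar>x\<bar> powr \<alpha> * fejer_kernel L x)" for \<alpha>
  define l where "l = 2 * real L / ln (5 * real L)"
  have lim: "(B_formula (real L) \<longlongrightarrow> l) (at_left 1)"
    unfolding l_def using L by (intro B_formula_tendsto) auto
  \<comment> \<open>On the period \<open>\<bar>x\<bar>\<close> is at most 1, so its powers decrease
    in the exponent.\<close>
  have J_mono: "J 1 \<le> J \<beta>" if "0 \<le> \<beta>" "\<beta> < 1" for \<beta>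
    unfolding J_def
  proof (intro integral_mono integrable_powr_times_fejer_kernel)
    fix x assume "x \<in> space unit_period"
    then show "\<bar>x\<bar> powr 1 * fejer_kernel L x \<le> \<bar>x\<bar> powr \<beta> * fejer_kernel L x"
      using that powr_mono'[of \<beta> 1 "\<bar>x\<bar>"] by (intro mult_right_mono fejer_kernel_nonneg) auto
  qed (use that in auto)
  have "\<forall>\<^sub>F \<beta> in at_left 1. B_formula (real L) \<beta> * J 1 \<le> 1"
  proof -
    have "\<forall>\<^sub>F \<beta> in at_left (1::real). 0 < \<beta> \<and> \<beta> < 1"
      using eventually_at_left_real[of 0 "1::real"] by simp
    \<comment> \<open>The limit \<open>l\<close> is positive because \<open>5 * L > 1\<close>;
      positivity nearby allows multiplying the comparison of moments by
      \<open>B_formula\<close>.\<close>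
    moreover have "\<forall>\<^sub>F \<beta> in at_left 1. 0 < B_formula (real L) \<beta>"
      using lim L by (intro order_tendstoD(1)) (auto simp: l_def)
    ultimately show ?thesis
    proof eventually_elim
      case (elim \<beta>)
      then have "B_formula (real L) \<beta> * J 1 \<le> B_formula (real L) \<beta> * J \<beta>"
        by (intro mult_left_mono J_mono) auto
      also have "\<dots> \<le> 1"
        unfolding J_def using elim L by (intro B_formula_times_integral_le) auto
      finally show ?case .
    qed
  qed
  then have "l * J 1 \<le> 1"
    by (intro tendsto_upperbound[OF tendsto_mult_right[OF lim]]) auto
  moreover have "Lim (at_left 1) (B_formula (real L)) = l"
    by (intro tendsto_Lim lim) simp
  ultimately show ?thesis
    using True by (simp add: B_const_def J_def)
qed

section \<open>Isolating one frequency\<close>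

lemma sin_times_fejer_kernel_times_cis:
  "complex_of_real (sin (2 * pi * real \<nu> * x)) * (of_real (fejer_kernel L x) * cis (- (2 * pi * real \<mu> * x))) =
    (\<Sum>j<L. \<Sum>l<L. cis (2 * pi * real_of_int (int j - int l + int \<nu> - int \<mu>) * x) -
        cis (2 * pi * real_of_int (int j - int l - int \<nu> - int \<mu>) * x)) / (2 * \<i> * of_nat L)"
proof -
  have sin: "complex_of_real (sin t) = (cis t - cis (- t)) / (2 * \<i>)" for t
    by (simp add: complex_eq_iff)
  have "(cis t - cis (- t)) * (cis u * cis (- v)) = cis (u + t - v) - cis (u - t - v)" for t u v
    by (simp add: left_diff_distrib cis_mult algebra_simps)
  note * = this[of "2 * pi * real \<nu> * x" _ "2 * pi * real \<mu> * x"]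
  have "(\<Sum>j<L. \<Sum>l<L. cis (2 * pi * real_of_int (int j - int l + int \<nu> - int \<mu>) * x) -
        cis (2 * pi * real_of_int (int j - int l - int \<nu> - int \<mu>) * x)) =
      (\<Sum>j<L. \<Sum>l<L. (cis (2 * pi * real \<nu> * x) - cis (- (2 * pi * real \<nu> * x))) *
        (cis (2 * pi * real_of_int (int j - int l) * x) * cis (- (2 * pi * real \<mu> * x))))"
    unfolding * by (simp add: algebra_simps)
  then show ?thesis
    unfolding of_real_fejer_kernel sin
    by (simp only: sum_distrib_left[symmetric] sum_distrib_right[symmetric]
        times_divide_eq_left times_divide_eq_right divide_divide_eq_left ac_simps)
qed

text \<open>Only zero frequencies survive integration. As \<open>\<bar>j - l\<bar> < L\<close>, the
  separation of the frequencies makes \<open>j - l + \<nu> - \<mu>\<close> vanish only for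
  \<open>\<nu> = \<mu>\<close> and \<open>j = l\<close>, and \<open>L \<le> \<mu>\<close> keeps
  \<open>j - l - \<nu> - \<mu>\<close> negative. The \<open>L\<close> diagonal pairs cancel the
  normalisation \<open>1 / L\<close>.\<close>

lemma has_bochner_integral_sin_fejer_kernel:
  fixes \<mu> \<nu> L :: nat
  assumes "0 < L" "L \<le> \<mu>" "0 < \<nu>" "\<nu> \<noteq> \<mu> \<Longrightarrow> int L \<le> \<bar>int \<nu> - int \<mu>\<bar>"
  shows "has_bochner_integral unit_period
    (\<lambda>x. complex_of_real (sin (2 * pi * real \<nu> * x)) * (of_real (fejer_kernel L x) * cis (- (2 * pi * real \<mu> * x))))
    (if \<nu> = \<mu> then 1 / (2 * \<i>) else 0)"
proof -
  have "has_bochner_integral unit_period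
    (\<lambda>x. (\<Sum>j<L. \<Sum>l<L. cis (2 * pi * real_of_int (int j - int l + int \<nu> - int \<mu>) * x) -
        cis (2 * pi * real_of_int (int j - int l - int \<nu> - int \<mu>) * x)) / (2 * \<i> * of_nat L))
    ((\<Sum>j<L. \<Sum>l<L. (if int j - int l + int \<nu> - int \<mu> = 0 then 1 else 0) -
        (if int j - int l - int \<nu> - int \<mu> = 0 then 1 else 0)) / (2 * \<i> * of_nat L))"
    by (intro has_bochner_integral_divide has_bochner_integral_sum has_bochner_integral_diff
        has_bochner_integral_cis_period)
  moreover have "(\<Sum>j<L. \<Sum>l<L. (if int j - int l + int \<nu> - int \<mu> = 0 then 1 else 0) -
        (if int j - int l - int \<nu> - int \<mu> = 0 then 1 else 0 :: complex)) =
      (\<Sum>j<L. \<Sum>l<L. if j = l \<and> \<nu> = \<mu> then 1 else 0)"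
  proof (intro sum.cong refl)
    fix j l assume "j \<in> {..<L}" "l \<in> {..<L}"
    then have "int j - int l + int \<nu> - int \<mu> = 0 \<longleftrightarrow> j = l \<and> \<nu> = \<mu>"
      "int j - int l - int \<nu> - int \<mu> \<noteq> 0"
      using assms by (cases "\<nu> = \<mu>"; auto)+
    then show "(if int j - int l + int \<nu> - int \<mu> = 0 then 1 else 0) -
        (if int j - int l - int \<nu> - int \<mu> = 0 then 1 else 0 :: complex) =
      (if j = l \<and> \<nu> = \<mu> then 1 else 0)"
      by simp
  qed
  moreover have "\<dots> / (2 * \<i> * of_nat L) = (if \<nu> = \<mu> then 1 / (2 * \<i>) else 0)"
    using assms by auto
  ultimately show ?thesis
    by (simp only: sin_times_fejer_kernel_times_cis)
qed

text \<open>Index 1 competes with \<open>n > 1\<close>, so the infimum is attained, and injectivity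
  of \<nu> makes it positive. Comparison with the smaller positive frequency \<open>\<nu> 1\<close>
  bounds it by \<open>\<nu> n\<close>, which is what excludes resonance with the negative
  frequencies of the sines.\<close>

lemma gap_bounds:
  assumes "\<forall>k\<in>idx N. 0 < \<nu> k" "strict_mono_on (idx N) \<nu>" "1 < n" "enat n < N"
  shows "0 < gap N \<nu> n" "gap N \<nu> n \<le> \<nu> n"
    and "m \<in> idx N \<Longrightarrow> m \<noteq> n \<Longrightarrow> int (gap N \<nu> n) \<le> \<bar>int (\<nu> m) - int (\<nu> n)\<bar>"
proof -
  let ?d = "\<lambda>m. nat \<bar>int (\<nu> m) - int (\<nu> n)\<bar>"
  have n: "n \<in> idx N" using assms by (auto simp: idx_def)
  have "1 \<in> idx N" using assms order.strict_implies_order[OF assms(4)] order_trans[of "enat 1" "enat n" N]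
    by (auto simp: idx_def)
  then have one: "1 \<in> idx N - {n}" using assms by auto
  have le: "gap N \<nu> n \<le> ?d m" if "m \<in> idx N - {n}" for m
    unfolding gap_def using that by (intro cINF_lower) auto
  then show "m \<in> idx N \<Longrightarrow> m \<noteq> n \<Longrightarrow> int (gap N \<nu> n) \<le> \<bar>int (\<nu> m) - int (\<nu> n)\<bar>"
    by force
  have "gap N \<nu> n \<in> ?d ` (idx N - {n})"
    unfolding gap_def using one by (intro Inf_nat_def1) auto
  then obtain m where "m \<in> idx N" "m \<noteq> n" "gap N \<nu> n = ?d m" by auto
  moreover have "\<nu> m \<noteq> \<nu> n"
    using strict_mono_on_imp_inj_on[OF assms(2)] n calculation by (auto dest: inj_onD)
  ultimately show "0 < gap N \<nu> n" by simp
  have "\<nu> 1 < \<nu> n"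
    using assms n one by (intro strict_mono_onD[OF assms(2)]) auto
  moreover have "0 < \<nu> 1" using assms(1) one by blast
  ultimately show "gap N \<nu> n \<le> \<nu> n" using le[OF one] by linarith
qed

section \<open>From partial sums to the full series\<close>

lemma integrable_sine_term: "integrable unit_period (sine_term \<nu> a k)"
  unfolding sine_term_def by (intro continuous_imp_integrable_real continuous_intros)

lemma is_sine_sum_integrable:
  assumes "is_sine_sum N \<nu> a f"
  shows "integrable unit_period f"
proof (cases N)
  case (enat M)
  then have "f = (\<lambda>x. \<Sum>k=1..M. sine_term \<nu> a k x)"
    using assms by (auto simp: is_sine_sum_def)
  then show ?thesis
    by (simp only: Bochner_Integration.integrable_sum integrable_sine_term)
next
  case infinity
  then obtain C where f: "f \<in> borel_measurable unit_period" "AE x in unit_period. cmod (f x) \<le> C"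
    using assms by (auto simp: is_sine_sum_def L_infinity_def)
  show ?thesis
  proof (rule Bochner_Integration.integrable_bound)
    show "integrable unit_period (\<lambda>_. C)"
      by (intro continuous_imp_integrable_real continuous_intros)
    show "AE x in unit_period. norm (f x) \<le> norm C"
      using f(2) by eventually_elim auto
  qed fact
qed

text \<open>This treats both cases of \<open>N\<close> at once: a finite sum is its own truncation
  with error 0, and an infinite series is approximated in the mean by a truncation that contains the
  index \<open>n\<close>.\<close>

lemma is_sine_sum_approx:
  assumes "is_sine_sum N \<nu> a f" "enat n < N" "0 < \<epsilon>"
  obtains M where "n \<le> M" "enat M \<le> N"
    "(LINT x|unit_period. cmod ((\<Sum>k=1..M. sine_term \<nu> a k x) - f x)) < \<epsilon>"
proof (cases N)
  case (enat M)
  then show ?thesis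
    using assms by (intro that[of M]) (auto simp: is_sine_sum_def)
next
  case infinity
  then have "(\<lambda>M. LINT x|unit_period. cmod ((\<Sum>k=1..M. sine_term \<nu> a k x) - f x)) \<longlonglongrightarrow> 0"
    using assms by (simp add: is_sine_sum_def)
  then have "\<forall>\<^sub>F M in sequentially.
      (LINT x|unit_period. cmod ((\<Sum>k=1..M. sine_term \<nu> a k x) - f x)) < \<epsilon>"
    using assms(3) by (rule order_tendstoD)
  then have "\<forall>\<^sub>F M in sequentially. n \<le> M \<and>
      (LINT x|unit_period. cmod ((\<Sum>k=1..M. sine_term \<nu> a k x) - f x)) < \<epsilon>"
    using eventually_ge_at_top[of n] by eventually_elim simp
  then obtain M where "n \<le> M"
      "(LINT x|unit_period. cmod ((\<Sum>k=1..M. sine_term \<nu> a k x) - f x)) < \<epsilon>"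
    using eventually_happens'[OF sequentially_bot] by blast
  then show ?thesis using infinity by (intro that) auto
qed

lemma integrable_mult_bounded_continuous:
  fixes f g :: "real \<Rightarrow> complex"
  assumes f: "integrable unit_period f" and g: "continuous_on UNIV g" and C: "\<And>x. cmod (g x) \<le> C"
  shows "integrable unit_period (\<lambda>x. f x * g x)"
proof (rule Bochner_Integration.integrable_bound)
  show "integrable unit_period (\<lambda>x. C * cmod (f x))"
    using f by (intro integrable_mult_right integrable_norm)
  have "g \<in> borel_measurable lborel"
    using borel_measurable_continuous_onI[OF g] by simp
  then have "g \<in> borel_measurable unit_period"
    by (intro measurable_restrict_space1 measurable_completion)
  then show "(\<lambda>x. f x * g x) \<in> borel_measurable unit_period"
    using f by (intro borel_measurable_times) auto
  have "0 \<le> C" using C[of 0] norm_ge_zero order_trans by blast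
  then show "AE x in unit_period. norm (f x * g x) \<le> norm (C * cmod (f x))"
    using mult_right_mono[OF C norm_ge_zero] by (intro AE_I2) (simp add: norm_mult mult.commute)
qed

text \<open>Every truncation containing \<open>n\<close> gives this value exactly. Since
  \<open>g\<close> is bounded, integration against it is continuous in the mean, so the value passes
  to \<open>f\<close>.\<close>

lemma integral_sine_sum_times_fejer_kernel:
  assumes "\<forall>k\<in>idx N. 0 < \<nu> k" "strict_mono_on (idx N) \<nu>" "is_sine_sum N \<nu> a f"
    and "1 < n" "enat n < N"
  defines "g \<equiv> \<lambda>x. complex_of_real (fejer_kernel (gap N \<nu> n) x) * cis (- (2 * pi * real (\<nu> n) * x))"
  shows "(LINT x|unit_period. f x * g x) = a n / (2 * \<i>)"
proof -
  define L where "L = gap N \<nu> n"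
  note gap = gap_bounds[OF assms(1,2,4,5), folded L_def]
  have gL: "cmod (g x) \<le> real L" for x
    by (simp add: g_def norm_mult fejer_kernel_nonneg fejer_kernel_le L_def)
  have g_cont: "continuous_on UNIV g"
    unfolding g_def cis_conv_exp by (intro continuous_intros continuous_fejer_kernel)
  note integrable_g = integrable_mult_bounded_continuous[OF _ g_cont gL]
  have f: "integrable unit_period f" using assms(3) by (rule is_sine_sum_integrable)
  have partial: "(LINT x|unit_period. (\<Sum>k=1..M. sine_term \<nu> a k x) * g x) = a n / (2 * \<i>)"
    if M: "n \<le> M" "enat M \<le> N" for M
  proof -
    have idx: "{1..M} \<subseteq> idx N"
      using M(2) order_trans[of "enat k" "enat M" N for k] by (auto simp: idx_def)
    have n: "n \<in> {1..M}" using M assms by auto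
    have eq: "\<nu> k = \<nu> n \<longleftrightarrow> k = n" if "k \<in> {1..M}" for k
      using strict_mono_on_imp_inj_on[OF assms(2)] that n idx
      by (meson inj_on_eq_iff subset_iff)
    have "has_bochner_integral unit_period (\<lambda>x. \<Sum>k=1..M. a k *
        (complex_of_real (sin (2 * pi * real (\<nu> k) * x)) * g x))
        (\<Sum>k=1..M. a k * (if \<nu> k = \<nu> n then 1 / (2 * \<i>) else 0))"
      unfolding g_def L_def[symmetric]
    proof (intro has_bochner_integral_sum has_bochner_integral_mult_right
        has_bochner_integral_sin_fejer_kernel)
      fix k assume k: "k \<in> {1..M}"
      show "0 < \<nu> k" using k idx assms(1) by blast
      assume "\<nu> k \<noteq> \<nu> n"
      then show "int L \<le> \<bar>int (\<nu> k) - int (\<nu> n)\<bar>" using k idx by (intro gap(3)) auto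
    qed (use gap in auto)
    then have "(LINT x|unit_period. (\<Sum>k=1..M. a k *
        (complex_of_real (sin (2 * pi * real (\<nu> k) * x)) * g x))) =
        (\<Sum>k=1..M. a k * (if \<nu> k = \<nu> n then 1 / (2 * \<i>) else 0))"
      by (rule has_bochner_integral_integral_eq)
    also have "\<dots> = (\<Sum>k=1..M. if k = n then a k / (2 * \<i>) else 0)"
      using eq by (intro sum.cong) auto
    also have "\<dots> = a n / (2 * \<i>)" using n by simp
    finally show ?thesis
      by (simp add: sine_term_def sum_distrib_right mult.assoc)
  qed
  have "cmod (a n / (2 * \<i>) - (LINT x|unit_period. f x * g x)) \<le> 0 + \<epsilon>" if \<epsilon>: "0 < \<epsilon>" for \<epsilon>
  proof -
    \<comment> \<open>Dividing by \<open>L\<close> compensates for the bound \<open>L\<close> on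
      \<open>g\<close>.\<close>
    have "0 < \<epsilon> / real L" using \<epsilon> gap(1) by simp
    then obtain M where M: "n \<le> M" "enat M \<le> N"
      "(LINT x|unit_period. cmod ((\<Sum>k=1..M. sine_term \<nu> a k x) - f x)) < \<epsilon> / real L"
      using is_sine_sum_approx[OF assms(3,5)] by blast
    define h where "h x = (\<Sum>k=1..M. sine_term \<nu> a k x)" for x
    have h: "integrable unit_period h"
      unfolding h_def by (intro Bochner_Integration.integrable_sum integrable_sine_term)
    have "a n / (2 * \<i>) - (LINT x|unit_period. f x * g x) =
        (LINT x|unit_period. h x * g x) - (LINT x|unit_period. f x * g x)"
      using partial[OF M(1,2)] by (simp add: h_def)
    also have "\<dots> = (LINT x|unit_period. (h x - f x) * g x)"
      using integrable_g f h by (simp add: left_diff_distrib)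
    also have "cmod \<dots> \<le> (LINT x|unit_period. real L * cmod (h x - f x))"
    proof (rule Bochner_Integration.integral_norm_bound_integral)
      show "norm ((h x - f x) * g x) \<le> real L * cmod (h x - f x)" for x
        using mult_right_mono[OF gL[of x], of "cmod (h x - f x)"] by (simp add: norm_mult mult.commute)
    qed (intro integrable_g integrable_mult_right integrable_norm Bochner_Integration.integrable_diff f h)+
    also have "\<dots> = real L * (LINT x|unit_period. cmod (h x - f x))" by simp
    also have "\<dots> \<le> real L * (\<epsilon> / real L)"
      using M(3) by (intro mult_left_mono) (auto simp: h_def)
    also have "\<dots> = 0 + \<epsilon>" using gap(1) by simp
    finally show ?thesis .
  qed
  then have "cmod (a n / (2 * \<i>) - (LINT x|unit_period. f x * g x)) \<le> 0"
    by (rule field_le_epsilon)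
  then show ?thesis by simp
qed

section \<open>Contradiction from a null exceptional set\<close>

theorem theorem2p2:
  fixes N :: enat and \<nu> :: "nat \<Rightarrow> nat" and a :: "nat \<Rightarrow> complex"
    and f :: "real \<Rightarrow> complex" and \<alpha> :: real and n :: nat
  assumes "\<forall>k\<in>idx N. 0 < \<nu> k"
    and "strict_mono_on (idx N) \<nu>"
    and "\<forall>k\<in>idx N. a k \<noteq> 0"
    and "is_sine_sum N \<nu> a f"
    and "\<alpha> \<in> {0..1}"
    and "1 < n" and "enat n < N"
  shows "\<exists>S. S \<subseteq> {-1/2..1/2} \<and> S \<in> sets lebesgue \<and> 0 < emeasure lebesgue S \<and>
           (\<forall>x\<in>S. cmod (f x) > 1/4 * B_const (real (gap N \<nu> n)) \<alpha> * cmod (a n) * \<bar>x\<bar> powr \<alpha>)"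
proof -
  define L where "L = gap N \<nu> n"
  define C where "C = 1/4 * B_const (real L) \<alpha> * cmod (a n)"
  define S where "S = {x \<in> space unit_period. C * \<bar>x\<bar> powr \<alpha> < cmod (f x)}"
  define g where "g x = complex_of_real (fejer_kernel L x) * cis (- (2 * pi * real (\<nu> n) * x))" for x
  have f: "integrable unit_period f" using assms(4) by (rule is_sine_sum_integrable)
  then have [measurable]: "f \<in> borel_measurable unit_period" by simp
  have "(\<lambda>x::real. \<bar>x\<bar> powr \<alpha>) \<in> borel_measurable lborel" by measurable
  then have [measurable]: "(\<lambda>x::real. \<bar>x\<bar> powr \<alpha>) \<in> borel_measurable unit_period"
    by (intro measurable_restrict_space1 measurable_completion)
  have S_sets: "S \<in> sets unit_period" unfolding S_def by measurable
  then have S: "S \<subseteq> {-1/2..1/2}" "S \<in> sets lebesgue"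
    by (auto simp: S_def sets_restrict_space_iff)
  have "0 < emeasure lebesgue S"
  proof (rule ccontr)
    assume "\<not> 0 < emeasure lebesgue S"
    \<comment> \<open>If \<open>S\<close> is null, the reverse inequality holds almost everywhere
      and can be integrated against the kernel.\<close>
    then have "emeasure unit_period S = 0"
      using S by (subst emeasure_restrict_space) auto
    then have "AE x in unit_period. cmod (f x) \<le> C * \<bar>x\<bar> powr \<alpha>"
      using S_sets by (intro AE_I[of _ _ S]) (auto simp: S_def)
    then have ae: "AE x in unit_period. cmod (f x * g x) \<le> C * (\<bar>x\<bar> powr \<alpha> * fejer_kernel L x)"
    proof eventually_elim
      case (elim x)
      then show ?case
        using mult_right_mono[OF elim fejer_kernel_nonneg[of L x]]
        by (simp add: g_def norm_mult fejer_kernel_nonneg mult.assoc)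
    qed
    \<comment> \<open>The majorant inherits its sign from the norm it dominates, whatever the sign
      of \<open>C\<close>.\<close>
    then have nonneg: "AE x in unit_period. 0 \<le> C * (\<bar>x\<bar> powr \<alpha> * fejer_kernel L x)"
      by eventually_elim (rule order_trans[OF norm_ge_zero])
    have "cmod (a n) / 2 = cmod (LINT x|unit_period. f x * g x)"
      unfolding g_def L_def using integral_sine_sum_times_fejer_kernel[OF assms(1,2,4,6,7)]
      by (simp add: norm_divide norm_mult)
    also have "\<dots> \<le> (LINT x|unit_period. cmod (f x * g x))"
      by (rule integral_norm_bound)
    also have "\<dots> \<le> (LINT x|unit_period. C * (\<bar>x\<bar> powr \<alpha> * fejer_kernel L x))"
      using ae nonneg assms(5)
      by (intro integral_mono_AE' integrable_mult_right integrable_powr_times_fejer_kernel) auto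
    also have "\<dots> = 1/4 * cmod (a n) * (B_const (real L) \<alpha> *
        (LINT x|unit_period. \<bar>x\<bar> powr \<alpha> * fejer_kernel L x))"
      by (simp add: C_def)
    also have "\<dots> \<le> 1/4 * cmod (a n) * 1"
      unfolding L_def using gap_bounds(1)[OF assms(1,2,6,7)] assms(5)
      by (intro mult_left_mono B_const_times_integral_le) auto
    \<comment> \<open>The chain bounds \<open>cmod (a n) / 2\<close> by
      \<open>cmod (a n) / 4\<close>; this factor of two is the room left by the constant
      1/4.\<close>
    finally have "a n = 0" by simp
    moreover have "n \<in> idx N" using assms(6,7) by (auto simp: idx_def)
    ultimately show False using assms(3) by blast
  qed
  moreover have "\<forall>x\<in>S. cmod (f x) > 1/4 * B_const (real (gap N \<nu> n)) \<alpha> * cmod (a n) * \<bar>x\<bar> powr \<alpha>"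
    unfolding S_def C_def L_def by blast
  ultimately show ?thesis
    using S by blast
qed

end
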